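(* Let $p$ be a prime and let $n$ be a non-negative integer with $n \leq p^2-1$. (1) Suppose $p \geq 5$ and the monomial $x^n$ is $2$-PN over $\mathbb{F}_{p^2}$. Then $n\in\{3,3p\}$ if $p\equiv -1\pmod{3}$, and $n\in\{3,3p,1+2p,2+p\}$ if $p\equiv 1\pmod{3}$. (2) If the monomial $x^n$ is $3$-PN over $\mathbb{F}_{p^2}$, then $n \in \{4, 4p\}$.
   Context: $\mathbb{F}_q$ denotes the finite field with $q$ elements. For a polynomial $f \in \mathbb{F}_q[x]$ and $a_1,\dots,a_k \in \mathbb{F}_q$, the $k$-th finite difference of $f$ in directions $(a_1,\dots,a_k)$ is defined recursively by $\nabla_{a}^1 f = f(x+a)-f(x)$ and $\nabla_{a_1,\dots,a_k}^k f = g(x+a_k)-g(x)$, where $g(x) = \nabla_{a_1,\dots,a_{k-1}}^{k-1} f$. The polynomial $f$ is called $k$-PN over $\mathbb{F}_q$ if, for every choice of $(a_1,\dots,a_k)$ with all $a_i \in \mathbb{F}_q$ and $a_i \neq 0$, the function $\mathbb{F}_q \to \mathbb{F}_q$ associated to $\nabla_{a_1,\dots,a_k}^k f$ is a bijection. *)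

theory Defs
  imports
    "HOL-Computational_Algebra.Polynomial"
    "HOL-Computational_Algebra.Primes"
    "HOL-Number_Theory.Cong"
    "HOL-Library.Cardinality"
begin

text \<open>The polynomial \<open>f(x + a) - f(x)\<close>, where \<open>[:a, 1:]\<close> is the polynomial \<open>x + a\<close>.\<close>

definition finite_diff :: "'a::comm_ring_1 poly \<Rightarrow> 'a \<Rightarrow> 'a poly" where
  "finite_diff f a = pcompose f [:a, 1:] - f"

text \<open>The directions are processed from left to right, so that
  \<open>iterated_diff f (as @ [a]) = finite_diff (iterated_diff f as) a\<close>;
  the list \<open>[a\<^sub>1, \<dots>, a\<^sub>k]\<close> gives the \<open>k\<close>-th finite difference in
  directions \<open>(a\<^sub>1, \<dots>, a\<^sub>k)\<close>.\<close>

definition iterated_diff :: "'a::comm_ring_1 poly \<Rightarrow> 'a list \<Rightarrow> 'a poly" where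
  "iterated_diff f as = foldl finite_diff f as"

text \<open>The finite field is the coefficient type.\<close>

definition k_PN :: "nat \<Rightarrow> 'a::{field, finite} poly \<Rightarrow> bool" where
  "k_PN k f \<longleftrightarrow>
     (\<forall>as. length as = k \<and> (\<forall>a\<in>set as. a \<noteq> 0) \<longrightarrow> bij (poly (iterated_diff f as)))"

end

theory Submission
  imports Defs
begin

text \<open>Write \<open>n = a + b p\<close> with digits \<open>a, b < p\<close>.

  On the prime field \<open>K\<close> the monomial agrees with \<open>x^m\<close>, where \<open>1 \<le> m \<le> p - 1\<close> and \<open>m\<close> is congruent
  to \<open>a + b\<close> modulo \<open>p - 1\<close>. Its \<open>(k - 1)\<close>-st difference \<open>g\<close> is planar on \<open>K\<close>, and for a planar
  function the sums of \<open>x^i g(x)^j\<close> over \<open>K\<close> vanish when \<open>2 (i + j) < p - 1\<close>. Choosing \<open>i\<close>, \<open>j\<close> with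
  \<open>i + j deg g = p - 1\<close> isolates a power of the leading coefficient. This forces \<open>deg g = 2\<close> or
  \<open>deg g = (p + 1) / 2\<close>, and the latter is impossible because the \<open>k\<close>-th difference would then be a
  permutation polynomial of degree \<open>(p - 1) / 2\<close>. So \<open>m = k + 1\<close>, and \<open>a + b\<close> is \<open>k + 1\<close> or \<open>p + k\<close>.

  If \<open>a + b = p + k\<close>, consider the correlation \<open>C\<^sub>f(d)\<close>, the sum of \<open>f(x + d) f(x)^p\<close> over the field.
  By homogeneity that of \<open>x^n\<close> is \<open>C(1) N(d)^(k+1)\<close> with \<open>N\<close> the norm to \<open>K\<close>, and \<open>C(1)\<close> is, up to sign,
  a product of two binomial coefficients that are nonzero modulo \<open>p\<close>. For the \<open>k\<close>-th difference, a
  bijection, the correlation at \<open>0\<close> vanishes. But it is also a \<open>2k\<close>-th difference of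
  \<open>C(1) N(d)^(k+1)\<close>, which is nonzero for suitable directions \<open>1\<close> and \<open>\<beta>\<close> with \<open>\<beta>^p = -\<beta>\<close>.
  The one case not covered is \<open>p = 5\<close>, \<open>k = 3\<close>, where \<open>x^n\<close> is constant off \<open>0\<close>.

  If \<open>a + b = k + 1\<close>, the \<open>k\<close>-th difference of \<open>x^n\<close> is additive up to a constant, and in the
  excluded cases a nontrivial zero of its additive part is written down.\<close>

subsection \<open>Power sums over finite fields\<close>

text \<open>\<open>G\<close> stands for a finite set of nonzero elements closed under products,
  which covers the nonzero elements both of the whole field and of its prime field.\<close>

lemma mult_closed_bij:
  fixes G :: "'a::idom set"
  assumes "finite G" "0 \<notin> G" "\<And>x y. x \<in> G \<Longrightarrow> y \<in> G \<Longrightarrow> x * y \<in> G" "a \<in> G"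
  shows "bij_betw ((*) a) G G"
proof -
  have "a \<noteq> 0"
    using assms by auto
  then have inj: "inj_on ((*) a) G"
    by (auto simp: inj_on_def)
  have "(*) a ` G \<subseteq> G"
    using assms by auto
  with inj assms(1) show ?thesis
    by (simp add: bij_betw_def endo_inj_surj)
qed

lemma mult_closed_power_card:
  fixes G :: "'a::idom set"
  assumes "finite G" "0 \<notin> G" "\<And>x y. x \<in> G \<Longrightarrow> y \<in> G \<Longrightarrow> x * y \<in> G" "a \<in> G"
  shows "a ^ card G = 1"
proof -
  have "(\<Prod>y\<in>G. y) = (\<Prod>y\<in>G. a * y)"
    using prod.reindex_bij_betw[OF mult_closed_bij[OF assms], of "\<lambda>x. x"] by simp
  also have "\<dots> = a ^ card G * (\<Prod>y\<in>G. y)"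
    by (simp add: prod.distrib)
  finally show ?thesis
    using assms(1,2) by simp
qed

lemma mult_closed_ex_power_ne_1:
  fixes G :: "'a::idom set"
  assumes "0 < r" "r < card G"
  shows "\<exists>a\<in>G. a ^ r \<noteq> 1"
proof (rule ccontr)
  assume "\<not> ?thesis"
  then have "monom 1 r = (1 :: 'a poly)"
    using assms by (intro poly_eqI_degree[of G]) (auto simp: poly_monom degree_monom_eq)
  with assms show False
    by (metis degree_1 degree_monom_eq less_numeral_extra(3) zero_neq_one)
qed

text \<open>Replacing x by a x multiplies the sum by a^m, so it vanishes once some a^m differs from
  1; if \<open>card G\<close> divides m, every term is 1.\<close>

lemma sum_power_mult_closed:
  fixes G :: "'a::idom set"
  assumes "finite G" "0 \<notin> G" "\<And>x y. x \<in> G \<Longrightarrow> y \<in> G \<Longrightarrow> x * y \<in> G"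
  shows "(\<Sum>x\<in>G. x ^ m) = (if card G dvd m then of_nat (card G) else 0)"
proof (cases "card G dvd m")
  case True
  then obtain c where "m = card G * c" ..
  then have "x ^ m = 1" if "x \<in> G" for x
    using mult_closed_power_card[OF assms that] by (simp add: power_mult)
  with True show ?thesis
    by simp
next
  case False
  show ?thesis
  proof (cases "G = {}")
    case nonempty: False
    \<comment> \<open>The reduced exponent is positive and below \<open>card G\<close>, so X^r - 1
      has too few roots to vanish on all of \<open>G\<close>.\<close>
    define r where "r = m mod card G"
    have "0 < r" "r < card G"
      using False nonempty assms(1) by (auto simp: r_def mod_greater_zero_iff_not_dvd card_gt_0_iff)
    then obtain a where a: "a \<in> G" "a ^ r \<noteq> 1"
      using mult_closed_ex_power_ne_1 by blast
    have "a ^ m = a ^ (card G * (m div card G) + r)"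
      by (simp add: r_def)
    also have "\<dots> = a ^ r"
      using mult_closed_power_card[OF assms a(1)] by (simp add: power_add power_mult)
    finally have am: "a ^ m \<noteq> 1"
      using a(2) by simp
    have "(\<Sum>x\<in>G. x ^ m) = (\<Sum>x\<in>G. (a * x) ^ m)"
      using sum.reindex_bij_betw[OF mult_closed_bij[OF assms a(1)], of "\<lambda>x. x ^ m"] by simp
    also have "\<dots> = a ^ m * (\<Sum>x\<in>G. x ^ m)"
      by (simp add: power_mult_distrib sum_distrib_left)
    finally show ?thesis
      using am False by simp
  qed simp
qed

lemma sum_power_insert_0:
  fixes K :: "'a::idom set"
  assumes "finite K" "0 \<in> K" "\<And>x y. x \<in> K \<Longrightarrow> y \<in> K \<Longrightarrow> x * y \<in> K"
    and "of_nat (card K) = (0 :: 'a)" "0 < m"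
  shows "(\<Sum>x\<in>K. x ^ m) = (if card K - 1 dvd m then - 1 else 0)"
proof -
  have "(\<Sum>x\<in>K. x ^ m) = (\<Sum>x\<in>K - {0}. x ^ m)"
    using assms by (simp add: sum.remove[of K 0])
  also have "\<dots> = (if card (K - {0}) dvd m then of_nat (card (K - {0})) else 0)"
    using assms by (intro sum_power_mult_closed) auto
  also have "of_nat (card (K - {0})) = (- 1 :: 'a)"
  proof -
    have "card K > 0"
      using assms card_gt_0_iff by blast
    then have "of_nat (card K - 1) = (of_nat (card K) - 1 :: 'a)"
      by (simp add: of_nat_diff)
    with assms show ?thesis
      by simp
  qed
  finally show ?thesis
    using assms by simp
qed

subsection \<open>Finite differences of polynomials\<close>

lemma coeff_finite_diff_above:
  "degree f \<le> n \<Longrightarrow> coeff (finite_diff f a) n = 0"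
proof (induction f arbitrary: n)
  case (pCons c f)
  \<comment> \<open>Product rule: (x + a) f(x + a) - x f(x) = x (f(x + a) - f(x)) + a f(x +
    a).\<close>
  have eq: "finite_diff (pCons c f) a = pCons 0 (finite_diff f a) + smult a (f \<circ>\<^sub>p [:a, 1:])"
    by (simp add: finite_diff_def pcompose_pCons algebra_simps)
  show ?case
  proof (cases "f = 0")
    case False
    then obtain k where k: "n = Suc k" "degree f \<le> k"
      using pCons.prems by (cases n) auto
    have "degree (f \<circ>\<^sub>p [:a, 1:]) < n"
      using degree_pcompose_le[of f "[:a, 1:]"] k by simp
    then show ?thesis
      unfolding eq using pCons.IH[OF k(2)] k(1) by (simp add: coeff_eq_0)
  qed (simp add: finite_diff_def pcompose_pCons)
qed (simp add: finite_diff_def)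

lemma coeff_pcompose_shift_top:
  fixes f :: "'a::comm_ring_1 poly"
  assumes "degree f \<le> n"
  shows "coeff (f \<circ>\<^sub>p [:a, 1:]) n = coeff f n"
  using coeff_finite_diff_above[OF assms, of a] by (simp add: finite_diff_def)

text \<open>On the top term, a difference in direction a acts as a times the derivative. If
  \<open>Suc n\<close> exceeds the degree, both sides are 0.\<close>

lemma coeff_finite_diff_top:
  fixes f :: "'a::comm_ring_1 poly"
  shows "degree f \<le> Suc n \<Longrightarrow> coeff (finite_diff f a) n = of_nat (Suc n) * a * coeff f (Suc n)"
proof (induction f arbitrary: n)
  case (pCons c f)
  have eq: "finite_diff (pCons c f) a = pCons 0 (finite_diff f a) + smult a (f \<circ>\<^sub>p [:a, 1:])"
    by (simp add: finite_diff_def pcompose_pCons algebra_simps)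
  have deg: "degree f \<le> n"
    using pCons.prems by (cases "f = 0") auto
  show ?case
  proof (cases n)
    case 0
    then show ?thesis
      unfolding eq using coeff_pcompose_shift_top[OF deg, of a] by simp
  next
    case (Suc k)
    then show ?thesis
      unfolding eq using coeff_pcompose_shift_top[OF deg, of a] pCons.IH[of k] deg
      by (simp add: algebra_simps)
  qed
qed (simp add: finite_diff_def)

lemma degree_finite_diff_le:
  fixes f :: "'a::comm_ring_1 poly"
  shows "degree (finite_diff f a) \<le> degree f - 1"
proof (intro degree_le allI impI)
  fix i assume "degree f - 1 < i"
  then show "coeff (finite_diff f a) i = 0"
    by (intro coeff_finite_diff_above) auto
qed

lemma iterated_diff_Nil [simp]: "iterated_diff f [] = f"
  and iterated_diff_Cons [simp]: "iterated_diff f (a # as) = iterated_diff (finite_diff f a) as"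
  by (simp_all add: iterated_diff_def)

lemma iterated_diff_snoc: "iterated_diff f (as @ [a]) = finite_diff (iterated_diff f as) a"
  by (simp add: iterated_diff_def)

lemma poly_finite_diff: "poly (finite_diff f a) x = poly f (x + a) - poly f x"
  by (simp add: finite_diff_def poly_pcompose add.commute)

text \<open>Meant for N = p - 1 and M = deg g, with i and j the remainder and the quotient. As N = j
  M + i, the claim amounts to i + 2 j < j M. Equality occurs for N = 8 with M = 3, and for N + 2 = 2
  M, where j = 1 and i = M - 2.\<close>

lemma div_mod_half_bound:
  fixes N M :: nat
  assumes "even N" "3 \<le> M" "M \<le> N" "N \<noteq> 8" "N + 2 \<noteq> 2 * M"
  shows "2 * (N mod M + N div M) < N"
proof -
  define i j where "i = N mod M" and "j = N div M"
  have N: "N = j * M + i" and i: "i < M"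
    using assms by (simp_all add: i_def j_def)
  have "j \<noteq> 0"
    using assms(2,3) by (simp add: j_def div_eq_0_iff)
  then consider "j = 1" | "j = 2" "M = 3" | "3 \<le> j" "M = 3" | "2 \<le> j" "4 \<le> M"
    using assms(2) by linarith
  then have "i + 2 * j < j * M"
  proof cases
    case 1
    moreover have "i \<noteq> M - 1" "i \<noteq> M - 2"
      using 1 N assms by auto
    ultimately show ?thesis
      using i by simp
  next
    case 2
    then show ?thesis
      using N i assms by auto
  next
    case 3
    then show ?thesis
      using i by simp
  next
    case 4
    then have "j * 4 \<le> j * M" "2 * M \<le> j * M"
      by simp_all
    then show ?thesis
      using i by linarith
  qed
  then have "2 * (i + j) < N"
    using N by simp
  then show ?thesis
    by (simp only: i_def j_def)
qed

lemma degree_iterated_diff_le: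
  fixes f :: "'a::comm_ring_1 poly"
  shows "degree (iterated_diff f as) \<le> degree f - length as"
proof (induction as arbitrary: f)
  case (Cons a as)
  then have "degree (iterated_diff f (a # as)) \<le> degree (finite_diff f a) - length as"
    by simp
  then show ?case
    using degree_finite_diff_le[of f a] by simp
qed simp

subsection \<open>The field with \<open>p\<^sup>2\<close> elements and its prime field\<close>

locale prime_square_field =
  fixes p :: nat and F :: "'a::{field, finite} itself"
  assumes prime_p: "prime p" and card_UNIV: "CARD('a) = p ^ 2"
begin

text \<open>Translation by 1 permutes the field, so comparing the sums of x and of x + 1 gives p^2 =
  0.\<close>

lemma of_nat_p: "of_nat p = (0 :: 'a)"
proof -
  have "bij_betw (\<lambda>x::'a. x + 1) UNIV UNIV"
    by (rule bij_betw_byWitness[where f' = "\<lambda>x. x - 1"]) auto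
  then have "(\<Sum>x\<in>UNIV. x) = (\<Sum>x\<in>UNIV. x + 1 :: 'a)"
    using sum.reindex_bij_betw[of "\<lambda>x::'a. x + 1" UNIV UNIV "\<lambda>x. x"] by simp
  then have "of_nat (p ^ 2) = (0 :: 'a)"
    using card_UNIV by (simp add: sum.distrib)
  then show ?thesis
    by simp
qed

lemma CHAR_eq: "CHAR('a) = p"
proof -
  have "CHAR('a) dvd p"
    using of_nat_p by (simp add: of_nat_eq_0_iff_char_dvd)
  then show ?thesis
    using prime_p CHAR_not_1' by (metis One_nat_def prime_nat_iff)
qed

lemma of_nat_eq_0_iff: "of_nat m = (0 :: 'a) \<longleftrightarrow> p dvd m"
  by (simp add: of_nat_eq_0_iff_char_dvd CHAR_eq)

lemma of_nat_binomial_neq_0: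
  assumes "k \<le> m" "m < p"
  shows "of_nat (m choose k) \<noteq> (0 :: 'a)"
proof
  assume "of_nat (m choose k) = (0 :: 'a)"
  then have "p dvd (m choose k)"
    by (simp add: of_nat_eq_0_iff)
  also have "(m choose k) dvd fact m"
    using assms(1) by (metis binomial_fact_lemma dvd_triv_right)
  finally show False
    using prime_p assms(2) by (simp add: prime_dvd_fact_iff)
qed

lemma p_gt_1: "1 < p"
  using prime_p prime_gt_1_nat by blast

lemma frob_add: "(x + y :: 'a) ^ p = x ^ p + y ^ p"
  by (rule freshmans_dream) (simp_all only: CHAR_eq prime_p)

lemma frob_minus: "(- x :: 'a) ^ p = - (x ^ p)"
  by (rule minus_power_prime_CHAR) (simp_all only: CHAR_eq prime_p)

lemma frob_diff: "(x - y :: 'a) ^ p = x ^ p - y ^ p"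
  using frob_add[of x "- y"] by (simp add: frob_minus)

lemma power_q_minus_1:
  assumes "x \<noteq> (0 :: 'a)"
  shows "x ^ (p ^ 2 - 1) = 1"
proof -
  have "x ^ card (UNIV - {0 :: 'a}) = 1"
    using assms by (intro mult_closed_power_card) auto
  then show ?thesis
    by (simp add: card_UNIV)
qed

lemma power_frob_frob: "(x :: 'a) ^ (p ^ 2) = x"
proof (cases "x = 0")
  case False
  then have "x ^ (p ^ 2 - 1) = 1"
    by (rule power_q_minus_1)
  moreover have "p ^ 2 = Suc (p ^ 2 - 1)"
    using p_gt_1 by simp
  then have "x ^ (p ^ 2) = x * x ^ (p ^ 2 - 1)"
    by (metis power_Suc)
  ultimately show ?thesis
    by simp
qed (use p_gt_1 in simp)

lemma frob_frob: "((x :: 'a) ^ p) ^ p = x"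
  using power_frob_frob[of x] by (simp add: power2_eq_square power_mult)

text \<open>The prime field, given as the fixed points of Frobenius, which makes the closure
  properties immediate.\<close>

definition K :: "'a set" where
  "K = {x. x ^ p = x}"

lemma K_0 [simp]: "0 \<in> K" and K_1 [simp]: "1 \<in> K"
  using p_gt_1 by (simp_all add: K_def)

lemma K_closed [intro]:
  assumes "x \<in> K" "y \<in> K"
  shows "x + y \<in> K" "x - y \<in> K" "x * y \<in> K"
  using assms by (simp_all add: K_def frob_add frob_diff power_mult_distrib)

lemma K_uminus [intro]: "x \<in> K \<Longrightarrow> - x \<in> K"
  by (simp add: K_def frob_minus)

lemma K_power [intro]: "x \<in> K \<Longrightarrow> x ^ m \<in> K"
  by (induction m) auto

lemma K_power_cong:
  assumes "x \<in> K" "x \<noteq> 0" "[m = n] (mod (p - 1))"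
  shows "x ^ m = x ^ n"
proof -
  have "x * x ^ (p - 1) = x * 1"
    using assms(1) p_gt_1 by (simp add: K_def flip: power_Suc)
  then have "x ^ (p - 1) = 1"
    using assms(2) by (metis mult_left_cancel)
  then have *: "x ^ k = x ^ (k mod (p - 1))" for k
    by (metis mult_div_mod_eq power_add power_mult power_one mult_1)
  show ?thesis
    using assms(3) *[of m] *[of n] by (simp add: cong_def)
qed

lemma of_nat_in_K: "of_nat m \<in> K"
  by (induction m) (auto simp: add.commute)

lemma finite_K [simp]: "finite K"
  by simp

lemma inj_on_of_nat: "inj_on (of_nat :: nat \<Rightarrow> 'a) {..<p}"
  by (auto simp: inj_on_def of_nat_eq_iff_cong_CHAR CHAR_eq cong_def)

text \<open>The p multiples of 1 lie in \<open>K\<close>, and the elements of \<open>K\<close> are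
  roots of X^p - X.\<close>

lemma card_K: "card K = p"
proof (rule antisym)
  have "card (of_nat ` {..<p} :: 'a set) \<le> card K"
    by (intro card_mono) (auto simp: of_nat_in_K)
  then show "p \<le> card K"
    by (simp add: card_image inj_on_of_nat)
  have "coeff (monom 1 p - [:0, 1 :: 'a:]) p = 1"
    using p_gt_1 by (auto simp: coeff_pCons split: nat.split)
  then have nz: "monom 1 p - [:0, 1 :: 'a:] \<noteq> 0"
    by (metis coeff_0 zero_neq_one)
  have "card K \<le> card {x::'a. poly (monom 1 p - [:0, 1:]) x = 0}"
    by (intro card_mono) (auto simp: K_def poly_monom)
  also have "\<dots> \<le> degree (monom 1 p - [:0, 1 :: 'a:])"
    by (rule card_poly_roots_bound[OF nz])
  also have "\<dots> \<le> p"
    using p_gt_1 by (intro degree_diff_le) (auto simp: degree_monom_le)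
  finally show "card K \<le> p" .
qed

lemma sum_power_K:
  assumes "0 < m"
  shows "(\<Sum>x\<in>K. x ^ m) = (if p - 1 dvd m then - 1 else 0)"
  using sum_power_insert_0[OF finite_K K_0 K_closed(3) _ assms] by (simp add: card_K of_nat_p)

lemma sum_power_UNIV:
  assumes "0 < m"
  shows "(\<Sum>x\<in>UNIV. x ^ m :: 'a) = (if p ^ 2 - 1 dvd m then - 1 else 0)"
  using sum_power_insert_0[of "UNIV :: 'a set" m] assms by (auto simp: card_UNIV of_nat_p)

text \<open>Frobenius is an involution, so x^p - x is negated by it; it is nonzero for x outside
  \<open>K\<close>.\<close>

lemma ex_anti_fixed: "\<exists>\<beta>::'a. \<beta> \<noteq> 0 \<and> \<beta> ^ p = - \<beta>"
proof -
  have "K \<noteq> UNIV"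
  proof
    assume "K = UNIV"
    then have "p = p ^ 2"
      using card_K card_UNIV by metis
    with p_gt_1 show False
      by (simp add: power2_eq_square)
  qed
  then obtain x where "x \<notin> K"
    by blast
  then have "x ^ p - x \<noteq> 0" "(x ^ p - x) ^ p = - (x ^ p - x)"
    by (simp_all add: K_def frob_diff frob_frob)
  then show ?thesis
    by blast
qed

text \<open>Among the exponents 0 to p - 1 only p - 1 has a nonzero power sum over \<open>K\<close>;
  exponent 0 contributes p = 0.\<close>

lemma sum_poly_K:
  assumes "degree h \<le> p - 1"
  shows "(\<Sum>x\<in>K. poly h x) = - coeff h (p - 1)"
proof -
  have "(\<Sum>x\<in>K. poly h x) = (\<Sum>x\<in>K. \<Sum>i\<le>p - 1. coeff h i * x ^ i)"
    using assms unfolding poly_altdef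
    by (intro sum.cong refl sum.mono_neutral_left) (auto simp: coeff_eq_0)
  also have "\<dots> = (\<Sum>i\<le>p - 1. coeff h i * (\<Sum>x\<in>K. x ^ i))"
    by (subst sum.swap) (simp add: sum_distrib_left)
  also have "\<dots> = (\<Sum>i\<in>{p - 1}. coeff h i * (\<Sum>x\<in>K. x ^ i))"
  proof (intro sum.mono_neutral_right ballI)
    fix i assume i: "i \<in> {..p - 1} - {p - 1}"
    show "coeff h i * (\<Sum>x\<in>K. x ^ i) = 0"
    proof (cases "i = 0")
      case False
      then have "\<not> p - 1 dvd i"
        using i by (auto dest: dvd_imp_le)
      with False show ?thesis
        by (simp add: sum_power_K)
    qed (simp add: card_K of_nat_p)
  qed auto
  also have "\<dots> = - coeff h (p - 1)"
    using p_gt_1 by (simp add: sum_power_K)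
  finally show ?thesis .
qed

subsection \<open>Planar functions on the prime field\<close>

text \<open>A first nonvanishing power sum \<open>P\<^sub>t\<close> would contribute
  the single term \<open>(2t choose t) P\<^sub>t\<^sup>2\<close> to the sum of \<open>(G x - G y)^(2t)\<close> over all pairs.\<close>

lemma planar_power_sum_eq_0:
  assumes G: "\<And>x. x \<in> K \<Longrightarrow> G x \<in> K"
    and planar: "\<And>a. a \<in> K \<Longrightarrow> a \<noteq> 0 \<Longrightarrow> inj_on (\<lambda>x. G (x + a) - G x) K"
  shows "2 * t < p - 1 \<Longrightarrow> (\<Sum>x\<in>K. G x ^ t) = 0"
proof (induction t rule: less_induct)
  case (less t)
  define P where "P j = (\<Sum>x\<in>K. G x ^ j)" for j
  show ?case
  proof (cases "t = 0")
    case False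
    \<comment> \<open>For nonzero a the difference permutes \<open>K\<close>, leaving a power sum
      with exponent strictly between 0 and p - 1; for a = 0 every term is 0.\<close>
    have diag: "(\<Sum>x\<in>K. (G (x + a) - G x) ^ (2 * t)) = 0" if a: "a \<in> K" for a
    proof (cases "a = 0")
      case nz: False
      have "(\<lambda>x. G (x + a) - G x) ` K \<subseteq> K"
        using G a by auto
      then have "bij_betw (\<lambda>x. G (x + a) - G x) K K"
        using planar[OF a nz] by (simp add: bij_betw_def endo_inj_surj)
      then have "(\<Sum>x\<in>K. (G (x + a) - G x) ^ (2 * t)) = (\<Sum>x\<in>K. x ^ (2 * t))"
        using sum.reindex_bij_betw[of "\<lambda>x. G (x + a) - G x" K K "\<lambda>x. x ^ (2 * t)"] by simp
      also have "\<dots> = 0"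
        using False less.prems by (subst sum_power_K) (auto dest: dvd_imp_le)
      finally show ?thesis .
    qed (use False in simp)
    have "0 = (\<Sum>a\<in>K. \<Sum>x\<in>K. (G (x + a) - G x) ^ (2 * t))"
      by (simp add: diag)
    also have "\<dots> = (\<Sum>x\<in>K. \<Sum>a\<in>K. (G (x + a) - G x) ^ (2 * t))"
      by (rule sum.swap)
    also have "\<dots> = (\<Sum>x\<in>K. \<Sum>y\<in>K. (G y - G x) ^ (2 * t))"
    proof (rule sum.cong[OF refl])
      fix x assume x: "x \<in> K"
      have "bij_betw ((+) x) K K"
        by (rule bij_betw_byWitness[where f' = "\<lambda>y. y - x"]) (use x in auto)
      from sum.reindex_bij_betw[OF this, of "\<lambda>y. (G y - G x) ^ (2 * t)"]
      show "(\<Sum>a\<in>K. (G (x + a) - G x) ^ (2 * t)) = (\<Sum>y\<in>K. (G y - G x) ^ (2 * t))" .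
    qed
    also have "\<dots> = (\<Sum>x\<in>K. \<Sum>y\<in>K. \<Sum>j\<le>2 * t.
        of_nat (2 * t choose j) * G y ^ j * (- G x) ^ (2 * t - j))"
      using binomial_ring[of _ "- G _" "2 * t"] by (simp del: power_minus_even)
    also have "\<dots> = (\<Sum>j\<le>2 * t. \<Sum>y\<in>K. \<Sum>x\<in>K.
        of_nat (2 * t choose j) * G y ^ j * (- G x) ^ (2 * t - j))"
      by (subst sum.swap, subst (2) sum.swap, subst sum.swap) simp
    also have "\<dots> = (\<Sum>j\<le>2 * t. of_nat (2 * t choose j) * (-1) ^ (2 * t - j) * P j * P (2 * t - j))"
      by (simp add: P_def sum_distrib_left sum_distrib_right power_minus[of "G _"] mult_ac)
    also have "\<dots> = (\<Sum>j\<in>{t}. of_nat (2 * t choose j) * (-1) ^ (2 * t - j) * P j * P (2 * t - j))"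
    proof (intro sum.mono_neutral_right ballI)
      fix j assume j: "j \<in> {..2 * t} - {t}"
      then have "j < t \<or> 2 * t - j < t"
        by auto
      then have "P j = 0 \<or> P (2 * t - j) = 0"
        using less.IH less.prems unfolding P_def by (meson less_trans mult_less_mono2 zero_less_numeral)
      then show "of_nat (2 * t choose j) * (-1) ^ (2 * t - j) * P j * P (2 * t - j) = 0"
        by auto
    qed auto
    finally have "of_nat (2 * t choose t) * P t ^ 2 = 0"
      by (simp add: power2_eq_square)
    moreover have "of_nat (2 * t choose t) \<noteq> (0 :: 'a)"
      using less.prems by (intro of_nat_binomial_neq_0) auto
    ultimately show ?thesis
      by (simp add: P_def)
  qed (simp add: card_K of_nat_p)
qed

text \<open>Directions in \<open>K\<close> never lead out of \<open>K\<close>. This allows x^n to be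
  replaced by a monomial of degree below p with the same values on \<open>K\<close>.\<close>

lemma poly_iterated_diff_cong_K:
  assumes "\<And>x. x \<in> K \<Longrightarrow> poly f x = poly g x" "set as \<subseteq> K" "x \<in> K"
  shows "poly (iterated_diff f as) x = poly (iterated_diff g as) x"
  using assms
proof (induction as arbitrary: f g)
  case (Cons a as)
  then have "poly (finite_diff f a) y = poly (finite_diff g a) y" if "y \<in> K" for y
    using that K_closed(1)[of y a] by (simp add: poly_finite_diff)
  with Cons.prems show ?case
    unfolding iterated_diff_Cons by (intro Cons.IH) auto
qed simp

lemma poly_iterated_diff_in_K:
  assumes "\<And>x. x \<in> K \<Longrightarrow> poly f x \<in> K" "set as \<subseteq> K" "x \<in> K"
  shows "poly (iterated_diff f as) x \<in> K"
  using assms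
proof (induction as arbitrary: f)
  case (Cons a as)
  then have "poly (finite_diff f a) y \<in> K" if "y \<in> K" for y
    using that K_closed(1)[of y a] by (simp add: poly_finite_diff K_closed(2))
  with Cons.prems show ?case
    unfolding iterated_diff_Cons by (intro Cons.IH) auto
qed simp

text \<open>Each difference multiplies the leading coefficient by the degree and the direction, and
  a positive degree below p is nonzero in the field.\<close>

lemma degree_iterated_diff:
  fixes f :: "'a poly"
  assumes "degree f < p" "length as \<le> degree f" "0 \<notin> set as"
  shows "degree (iterated_diff f as) = degree f - length as"
  using assms
proof (induction as arbitrary: f)
  case (Cons a as)
  obtain d where d: "degree f = Suc d"
    using Cons.prems by (cases "degree f") auto
  have "\<not> p dvd Suc d"
    using Cons.prems d by (metis dvd_imp_le not_less zero_less_Suc)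
  then have "of_nat (Suc d) \<noteq> (0 :: 'a)"
    by (simp only: of_nat_eq_0_iff not_False_eq_True)
  moreover have "coeff f (Suc d) \<noteq> 0"
    using d by (metis degree_0 leading_coeff_0_iff nat.distinct(1))
  ultimately have "coeff (finite_diff f a) d \<noteq> 0"
    using coeff_finite_diff_top[of f d a] Cons.prems d by simp
  then have "degree (finite_diff f a) = d"
    using degree_finite_diff_le[of f a] d by (intro antisym le_degree) simp_all
  then show ?case
    using Cons d by simp
qed simp

text \<open>Adding c x to g preserves planarity, so the sum of (c x + g(x))^t with t = i + j
  vanishes for every c in \<open>K\<close>. As a polynomial in c, here \<open>q\<close>, it has
  degree at most t < p but p roots, so all its coefficients vanish; the i-th is the mixed sum times
  a nonzero binomial coefficient.\<close>

lemma planar_mixed_sum_eq_0: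
  assumes g: "\<And>x. x \<in> K \<Longrightarrow> g x \<in> K"
    and planar: "\<And>a. a \<in> K \<Longrightarrow> a \<noteq> 0 \<Longrightarrow> inj_on (\<lambda>x. g (x + a) - g x) K"
    and small: "2 * (i + j) < p - 1"
  shows "(\<Sum>x\<in>K. x ^ i * g x ^ j) = 0"
proof -
  define t where "t = i + j"
  define S where "S k = (\<Sum>x\<in>K. x ^ k * g x ^ (t - k))" for k
  define q where "q = (\<Sum>k\<le>t. monom (of_nat (t choose k) * S k) k)"
  have "poly q c = 0" if c: "c \<in> K" for c
  proof -
    have "poly q c = (\<Sum>k\<le>t. \<Sum>x\<in>K. of_nat (t choose k) * (c * x) ^ k * g x ^ (t - k))"
      by (simp add: q_def S_def poly_sum poly_monom sum_distrib_left sum_distrib_right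
          power_mult_distrib mult_ac)
    also have "\<dots> = (\<Sum>x\<in>K. (c * x + g x) ^ t)"
      by (subst sum.swap) (simp add: binomial_ring)
    also have "\<dots> = 0"
    proof (rule planar_power_sum_eq_0)
      fix a assume a: "a \<in> K" "a \<noteq> 0"
      have "inj_on (\<lambda>x. (g (x + a) - g x) + c * a) K"
        using planar[OF a] by (simp add: inj_on_def)
      then show "inj_on (\<lambda>x. c * (x + a) + g (x + a) - (c * x + g x)) K"
        by (simp add: algebra_simps)
    qed (use c g small in \<open>auto simp: t_def\<close>)
    finally show ?thesis .
  qed
  moreover have "degree q \<le> t"
    unfolding q_def by (intro degree_sum_le) (auto intro: order.trans[OF degree_monom_le])
  ultimately have "q = 0"
    using small by (intro poly_eqI_degree[of K]) (auto simp: card_K t_def)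
  then have "of_nat (t choose i) * S i = 0"
    unfolding q_def poly_eq_iff by (auto simp: coeff_sum t_def dest: spec[of _ i])
  moreover have "of_nat (t choose i) \<noteq> (0 :: 'a)"
    using small by (intro of_nat_binomial_neq_0) (auto simp: t_def)
  ultimately show ?thesis
    by (simp add: S_def t_def)
qed

text \<open>Otherwise the sum of x^i g(x)^j over \<open>K\<close> would be 0, yet X^i g^j has degree
  exactly p - 1, so the sum is minus its leading coefficient.\<close>

lemma planar_poly_degree:
  assumes g: "\<And>x. x \<in> K \<Longrightarrow> poly g x \<in> K"
    and planar: "\<And>a. a \<in> K \<Longrightarrow> a \<noteq> 0 \<Longrightarrow> inj_on (\<lambda>x. poly g (x + a) - poly g x) K"
    and deg: "3 \<le> degree g" "degree g \<le> p - 1"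
  shows "2 * degree g = p + 1"
proof (rule ccontr)
  assume ne: "2 * degree g \<noteq> p + 1"
  define i j where "i = (p - 1) mod degree g" and "j = (p - 1) div degree g"
  have "p \<noteq> 2"
    using deg by auto
  then have "even (p - 1)"
    using prime_p by (simp add: prime_odd_nat p_gt_1 order_neq_le_trans prime_ge_2_nat)
  \<comment> \<open>This rules out the exceptional value N = 8 of the arithmetic bound.\<close>
  moreover have "p \<noteq> 9"
  proof
    assume "p = 9"
    with prime_p have "\<forall>m. m dvd (9 :: nat) \<longrightarrow> m = 1 \<or> m = 9"
      by (simp add: prime_nat_iff)
    then show False
      by (elim allE[of _ 3]) simp
  qed
  ultimately have "2 * (i + j) < p - 1"
    unfolding i_def j_def using deg ne by (intro div_mod_half_bound) auto
  then have "(\<Sum>x\<in>K. x ^ i * poly g x ^ j) = 0"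
    using planar_mixed_sum_eq_0[of "poly g"] g planar by blast
  then have "(\<Sum>x\<in>K. poly (monom 1 i * g ^ j) x) = 0"
    by (simp add: poly_monom)
  moreover have "g \<noteq> 0"
    using deg by auto
  then have nz: "monom 1 i * g ^ j \<noteq> 0"
    by simp
  have "degree (monom 1 i * g ^ j) = p - 1"
    using nz \<open>g \<noteq> 0\<close> by (simp add: degree_mult_eq degree_power_eq degree_monom_eq i_def j_def)
  ultimately show False
    using sum_poly_K[of "monom 1 i * g ^ j"] nz by (metis leading_coeff_0_iff neg_equal_0_iff_equal order_refl)
qed

section \<open>The exponent modulo \<open>p - 1\<close>\<close>

lemma
  assumes pn: "k_PN k (monom 1 n :: 'a poly)" and "1 \<le> k"
  shows k_PN_exponent_neq_0: "n \<noteq> 0" and k_PN_exponent_cong: "[n = k + 1] (mod (p - 1))"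
proof -
  have pos: "0 < p - 1"
    using p_gt_1 by simp
  define f where "f = (monom 1 n :: 'a poly)"
  show "n \<noteq> 0"
  proof
    assume "n = 0"
    have "poly (iterated_diff f (replicate k 1)) x = coeff (iterated_diff f (replicate k 1)) 0" for x
      using degree_iterated_diff_le[of f "replicate k 1"] \<open>n = 0\<close> poly_altdef[of "iterated_diff f (replicate k 1)" x]
      by (simp add: f_def degree_monom_eq)
    moreover have "inj (poly (iterated_diff f (replicate k 1)))"
      using pn by (simp add: k_PN_def f_def bij_def)
    ultimately show False
      by (metis injD zero_neq_one)
  qed
  \<comment> \<open>The representative is taken in 1, ..., p - 1 rather than 0, ..., p - 2, so that
    x^n and x^m agree at 0 as well.\<close>
  define m where "m = (n - 1) mod (p - 1) + 1"
  define f' where "f' = (monom 1 m :: 'a poly)"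
  have m: "1 \<le> m" "m \<le> p - 1"
    using mod_less_divisor[OF pos, of "n - 1"] unfolding m_def by linarith+
  have cong: "[n = m] (mod (p - 1))"
    using \<open>n \<noteq> 0\<close> unfolding m_def cong_def by (metis Suc_eq_plus1 Suc_pred' mod_Suc_eq neq0_conv)
  have agree: "poly f x = poly f' x" if "x \<in> K" for x
  proof (cases "x = 0")
    case False
    then have "x ^ n = x ^ m"
      using K_power_cong[OF that _ cong] by simp
    then show ?thesis
      by (simp add: f_def f'_def poly_monom)
  qed (use \<open>n \<noteq> 0\<close> m in \<open>simp add: f_def f'_def poly_monom power_0_left\<close>)
  have f'_K: "poly f' x \<in> K" if "x \<in> K" for x
    using that by (auto simp: f'_def poly_monom)
  have deg_f': "degree f' = m"
    by (simp add: f'_def degree_monom_eq)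
  define D where "D as = iterated_diff f' as" for as
  have inj: "inj_on (poly (D as)) K" if "length as = k" "set as \<subseteq> K - {0}" for as
  proof -
    have "inj (poly (iterated_diff f as))"
      using pn that by (auto simp: k_PN_def f_def bij_def)
    moreover have "poly (iterated_diff f as) x = poly (D as) x" if "x \<in> K" for x
      unfolding D_def using agree \<open>set as \<subseteq> K - {0}\<close> that by (intro poly_iterated_diff_cong_K) auto
    ultimately show ?thesis
      by (metis inj_onI injD)
  qed
  \<comment> \<open>One more difference of \<open>g\<close> is a k-th difference of the monomial, so
    \<open>g\<close> is planar on \<open>K\<close>.\<close>
  define g where "g = D (replicate (k - 1) 1)"
  have g_K: "poly g x \<in> K" if "x \<in> K" for x
    unfolding g_def D_def using f'_K that by (intro poly_iterated_diff_in_K) auto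
  have diff_g: "finite_diff g a = D (replicate (k - 1) 1 @ [a])" for a
    by (simp add: g_def D_def iterated_diff_snoc)
  have inj_g: "inj_on (poly (finite_diff g a)) K" if "a \<in> K" "a \<noteq> 0" for a
    unfolding diff_g using that \<open>1 \<le> k\<close> by (intro inj) auto
  have "k < m"
  proof (rule ccontr)
    assume "\<not> k < m"
    then have "degree (D (replicate k 1)) = 0"
      using degree_iterated_diff_le[of f' "replicate k 1"] by (simp add: D_def deg_f')
    then have "poly (D (replicate k 1)) 0 = poly (D (replicate k 1)) 1"
      by (simp add: poly_altdef)
    moreover have "inj_on (poly (D (replicate k 1))) K"
      by (intro inj) auto
    ultimately show False
      by (meson K_0 K_1 inj_on_def zero_neq_one)
  qed
  have deg_g: "degree g = m - (k - 1)"
    unfolding g_def D_def using m \<open>k < m\<close> p_gt_1 by (subst degree_iterated_diff) (auto simp: deg_f')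
  have "degree g < 3"
  proof (rule ccontr)
    assume "\<not> degree g < 3"
    have "2 * degree g = p + 1"
      using \<open>\<not> degree g < 3\<close> deg_g m g_K inj_g
      by (intro planar_poly_degree) (auto simp: poly_finite_diff [abs_def])
    \<comment> \<open>In the exceptional case \<open>h\<close> permutes \<open>K\<close> and has
      degree (p - 1) / 2. The sum of its squares is then that of all x^2, which is 0, although
      \<open>h ^ 2\<close> has degree p - 1.\<close>
    define h where "h = finite_diff g 1"
    have "degree h = m - k"
      unfolding h_def diff_g D_def using m \<open>k < m\<close> p_gt_1 \<open>1 \<le> k\<close>
      by (subst degree_iterated_diff) (auto simp: deg_f')
    then have deg_h: "2 * degree h = p - 1" "2 \<le> degree h"
      using deg_g \<open>k < m\<close> \<open>1 \<le> k\<close> \<open>2 * degree g = p + 1\<close> \<open>\<not> degree g < 3\<close> by auto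
    then have "h \<noteq> 0"
      by auto
    have "poly h ` K \<subseteq> K"
      unfolding h_def using g_K K_closed(1)[OF _ K_1] by (auto simp: poly_finite_diff K_closed(2))
    then have "bij_betw (poly h) K K"
      using inj_g[of 1] by (simp add: h_def bij_betw_def endo_inj_surj)
    then have "(\<Sum>x\<in>K. poly h x ^ 2) = (\<Sum>x\<in>K. x ^ 2)"
      using sum.reindex_bij_betw[of "poly h" K K "\<lambda>x. x ^ 2"] by simp
    also have "\<dots> = 0"
      using deg_h by (subst sum_power_K) (auto dest: dvd_imp_le)
    finally have "(\<Sum>x\<in>K. poly (h ^ 2) x) = 0"
      by simp
    moreover have "degree (h ^ 2) = p - 1"
      using deg_h \<open>h \<noteq> 0\<close> by (simp add: degree_power_eq)
    ultimately show False
      using sum_poly_K[of "h ^ 2"] \<open>h \<noteq> 0\<close>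
      by (metis leading_coeff_0_iff neg_equal_0_iff_equal order_refl power_not_zero)
  qed
  then have "m = k + 1"
    using deg_g \<open>k < m\<close> \<open>1 \<le> k\<close> by simp
  with cong show "[n = k + 1] (mod (p - 1))"
    by simp
qed

subsection \<open>Correlation sums\<close>

text \<open>An autocorrelation with Frobenius as conjugation; at d = 0 it is the sum of the norms of
  the values.\<close>

definition corr :: "('a \<Rightarrow> 'a) \<Rightarrow> 'a \<Rightarrow> 'a" where
  "corr f d = (\<Sum>x\<in>UNIV. f (x + d) * f x ^ p)"

lemma sum_UNIV_shift: "(\<Sum>x\<in>UNIV. h (x + a)) = (\<Sum>x\<in>UNIV. h (x :: 'a) :: 'a)"
proof -
  have "bij (\<lambda>x. x + a)"
    by (rule bij_betw_byWitness[where f' = "\<lambda>x. x - a"]) auto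
  then show ?thesis
    using sum.reindex_bij_betw[of "\<lambda>x. x + a" UNIV UNIV h] by simp
qed

text \<open>Expanding the product of the two differences and translating the summation variable turns
  \<open>corr\<close> of a difference into a second difference of \<open>corr\<close>.\<close>

lemma corr_finite_diff:
  "corr (poly (finite_diff f a)) d =
    2 * corr (poly f) d - corr (poly f) (d + a) - corr (poly f) (d - a)"
proof -
  define g where "g = poly f"
  have "corr (poly (finite_diff f a)) d =
      (\<Sum>x\<in>UNIV. g ((x + a) + d) * g (x + a) ^ p + g (x + d) * g x ^ p
        - g (x + (d + a)) * g x ^ p - g ((x + a) + (d - a)) * g (x + a) ^ p)"
    by (simp add: corr_def poly_finite_diff frob_diff algebra_simps flip: g_def)
  also have "\<dots> = 2 * corr g d - corr g (d + a) - corr g (d - a)"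
    using sum_UNIV_shift[of "\<lambda>x. g (x + d) * g x ^ p" a]
      sum_UNIV_shift[of "\<lambda>x. g (x + (d - a)) * g x ^ p" a]
    by (simp add: corr_def sum.distrib sum_subtractf)
  finally show ?thesis
    by (simp add: g_def)
qed

text \<open>For a bijection this is the power sum with exponent p + 1, which p^2 - 1 does not divide
  when p is at least 3.\<close>

lemma corr_bij_0:
  assumes "bij f" "3 \<le> p"
  shows "corr f 0 = 0"
proof -
  have "corr f 0 = (\<Sum>x\<in>UNIV. f x ^ (p + 1))"
    by (simp add: corr_def)
  also have "\<dots> = (\<Sum>x\<in>UNIV. x ^ (p + 1))"
    using sum.reindex_bij_betw[OF assms(1), of "\<lambda>x. x ^ (p + 1)"] .
  also have "\<dots> = 0"
  proof -
    have "\<not> p ^ 2 - 1 dvd p + 1"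
    proof
      assume "p ^ 2 - 1 dvd p + 1"
      then have "p ^ 2 - 1 \<le> p + 1"
        by (rule dvd_imp_le) simp
      moreover have "3 * p \<le> p ^ 2"
        using assms(2) by (simp add: power2_eq_square)
      ultimately show False
        using assms(2) by linarith
    qed
    then show ?thesis
      by (subst sum_power_UNIV) auto
  qed
  finally show ?thesis .
qed

lemma norm_in_K: "x ^ (p + 1) \<in> K"
  by (simp add: K_def power_mult_distrib frob_frob mult.commute)

text \<open>For nonzero d, substituting d x for x pulls out the norm of d to the power n; the norm
  lies in \<open>K\<close>, so n may be replaced by m. At d = 0 the power sum with exponent n (p +
  1) vanishes because p - 1 does not divide n.\<close>

lemma corr_power:
  assumes "n \<noteq> 0" "[n = m] (mod (p - 1))" "\<not> p - 1 dvd m"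
  shows "corr (\<lambda>x. x ^ n) d = corr (\<lambda>x. x ^ n) 1 * (d ^ (p + 1)) ^ m"
proof (cases "d = 0")
  case True
  have "\<not> p - 1 dvd n"
    using assms(2,3) by (simp add: cong_dvd_iff)
  moreover have "p ^ 2 - 1 = (p - 1) * (p + 1)"
    by (simp add: power2_eq_square algebra_simps)
  ultimately have "\<not> p ^ 2 - 1 dvd n * (p + 1)"
    using dvd_mult_cancel2 by (metis dvd_times_right_cancel_iff add_is_0 one_neq_zero)
  moreover have "corr (\<lambda>x. x ^ n) 0 = (\<Sum>x\<in>UNIV. x ^ (n * (p + 1)))"
    by (simp add: corr_def power_add power_mult)
  ultimately have "corr (\<lambda>x. x ^ n) 0 = 0"
    using assms(1) by (simp add: sum_power_UNIV del: mult_Suc_right)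
  moreover have "m \<noteq> 0"
    using assms(3) by (cases m) auto
  ultimately show ?thesis
    using True by simp
next
  case False
  have "bij ((*) d)"
    using False by (intro bij_betw_byWitness[where f' = "\<lambda>x. x / d"]) auto
  then have "corr (\<lambda>x. x ^ n) d = (\<Sum>x\<in>UNIV. (d * x + d) ^ n * ((d * x) ^ n) ^ p)"
    unfolding corr_def
    using sum.reindex_bij_betw[of "(*) d" UNIV UNIV "\<lambda>x. (x + d) ^ n * (x ^ n) ^ p"] by simp
  also have "\<dots> = (\<Sum>x\<in>UNIV. (d ^ (p + 1)) ^ n * ((x + 1) ^ n * (x ^ n) ^ p))"
  proof (rule sum.cong[OF refl])
    fix x
    have "d * x + d = d * (x + 1)"
      by (simp add: algebra_simps)
    moreover have "d ^ n * (d ^ n) ^ p = (d ^ (p + 1)) ^ n"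
      by (simp add: power_mult_distrib mult.commute flip: power_mult)
    ultimately show "(d * x + d) ^ n * ((d * x) ^ n) ^ p =
        (d ^ (p + 1)) ^ n * ((x + 1) ^ n * (x ^ n) ^ p)"
      by (simp add: power_mult_distrib mult_ac del: power_Suc)
  qed
  also have "(d ^ (p + 1)) ^ n = (d ^ (p + 1)) ^ m"
    using False assms(2) by (intro K_power_cong norm_in_K) auto
  finally show ?thesis
    by (simp add: corr_def mult.commute flip: sum_distrib_left)
qed

text \<open>The bounds keep e + p f positive and below 2 (p^2 - 1), so divisibility means equality
  with p^2 - 1. Reading this modulo p gives e + 1 = p, since e + 1 < 2 p.\<close>

lemma p2_dvd_digits_iff:
  assumes "0 < e" "e + 3 \<le> 2 * p" "f + 3 \<le> 2 * p"
  shows "p ^ 2 - 1 dvd e + p * f \<longleftrightarrow> e = p - 1 \<and> f = p - 1"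
proof
  assume "p ^ 2 - 1 dvd e + p * f"
  then obtain c where c: "e + p * f = (p ^ 2 - 1) * c" ..
  have "p * (f + 3) \<le> p * (2 * p)"
    using assms(3) by (intro mult_left_mono) auto
  then have "p * f + 3 * p \<le> 2 * p ^ 2"
    by (simp add: power2_eq_square algebra_simps)
  then have "e + p * f < (p ^ 2 - 1) * 2"
    using assms(2) p_gt_1 by simp
  with c have "c < 2"
    by (metis mult_less_cancel1)
  moreover have "c \<noteq> 0"
    using c assms(1) by (cases c) auto
  ultimately have "c = 1"
    by simp
  then have eq: "(e + 1) + p * f = p * p"
    using c p_gt_1 by (simp add: power2_eq_square)
  then have "p dvd e + 1"
    by (metis dvd_add_left_iff dvd_triv_left)
  then obtain j where j: "e + 1 = p * j" ..
  have "p * j < p * 2"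
    using j assms(2) by linarith
  then have "j < 2"
    using mult_less_cancel1 by blast
  moreover have "j \<noteq> 0"
    using j by (cases j) auto
  ultimately have "e + 1 = p"
    using j by (cases "j = 1") auto
  with eq have "p * (f + 1) = p * p"
    by simp
  then have "f + 1 = p"
    using p_gt_1 by (metis mult_left_cancel not_one_less_zero)
  with \<open>e + 1 = p\<close> show "e = p - 1 \<and> f = p - 1"
    by linarith
next
  assume "e = p - 1 \<and> f = p - 1"
  then have "e + p * f = p ^ 2 - 1"
    using p_gt_1 by (simp add: power2_eq_square algebra_simps)
  then show "p ^ 2 - 1 dvd e + p * f"
    by simp
qed

text \<open>With n = a + b p, (x + 1)^n = (x + 1)^a (x^p + 1)^b, and Frobenius swaps the digits of
  x^n. After expansion only the term r = p - 1 - b, s = p - 1 - a has a nonzero power sum;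
  \<open>p \<le> a + b\<close> puts these indices in range.\<close>

lemma corr_power_1_neq_0:
  assumes "a < p" "b < p" "p \<le> a + b" "a + b + 3 \<le> 2 * p"
  shows "corr (\<lambda>x. x ^ (a + b * p)) 1 \<noteq> 0"
proof -
  have pos: "0 < a" "0 < b"
    using assms by auto
  have expand: "(x + 1) ^ (a + b * p) * (x ^ (a + b * p)) ^ p =
      (\<Sum>r\<le>a. \<Sum>s\<le>b. of_nat (a choose r) * of_nat (b choose s) * x ^ ((r + b) + p * (s + a)))"
    for x :: 'a
  proof -
    have "(x + 1) ^ (a + b * p) = (x + 1) ^ a * (x ^ p + 1) ^ b"
      by (simp add: power_add frob_add mult.commute[of b] power_mult)
    also have "\<dots> = (\<Sum>r\<le>a. of_nat (a choose r) * x ^ r) * (\<Sum>s\<le>b. of_nat (b choose s) * (x ^ p) ^ s)"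
      by (simp add: binomial_ring)
    finally have 1: "(x + 1) ^ (a + b * p) =
      (\<Sum>r\<le>a. \<Sum>s\<le>b. of_nat (a choose r) * x ^ r * (of_nat (b choose s) * (x ^ p) ^ s))"
      by (simp add: sum_product)
    have "(x ^ (a + b * p)) ^ p = (x ^ p) ^ a * ((x ^ p) ^ p) ^ b"
      by (simp add: power_add power_mult_distrib mult_ac flip: power_mult)
    then have 2: "(x ^ (a + b * p)) ^ p = (x ^ p) ^ a * x ^ b"
      by (simp only: frob_frob)
    show ?thesis
      unfolding 1 2 sum_distrib_right
      by (intro sum.cong refl) (simp add: power_add power_mult mult_ac)
  qed
  have "corr (\<lambda>x. x ^ (a + b * p)) 1 =
      (\<Sum>r\<le>a. \<Sum>s\<le>b. \<Sum>x\<in>UNIV.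
        of_nat (a choose r) * of_nat (b choose s) * x ^ ((r + b) + p * (s + a)))"
    unfolding corr_def expand by (subst sum.swap, subst (2) sum.swap) simp
  also have "\<dots> = (\<Sum>r\<le>a. \<Sum>s\<le>b. of_nat (a choose r) * of_nat (b choose s) *
      (\<Sum>x\<in>UNIV. x ^ ((r + b) + p * (s + a))))"
    by (simp only: sum_distrib_left)
  also have "\<dots> = (\<Sum>r\<le>a. \<Sum>s\<le>b. if r = p - 1 - b \<and> s = p - 1 - a
      then - (of_nat (a choose r) * of_nat (b choose s)) else 0)"
  proof (intro sum.cong refl)
    fix r s assume "r \<in> {..a}" "s \<in> {..b}"
    then have "p ^ 2 - 1 dvd (r + b) + p * (s + a) \<longleftrightarrow> r + b = p - 1 \<and> s + a = p - 1"
      using pos assms by (intro p2_dvd_digits_iff) auto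
    moreover have "r + b = p - 1 \<and> s + a = p - 1 \<longleftrightarrow> r = p - 1 - b \<and> s = p - 1 - a"
      using assms by auto
    ultimately have "(\<Sum>x\<in>UNIV. x ^ ((r + b) + p * (s + a))) =
        (if r = p - 1 - b \<and> s = p - 1 - a then - 1 else 0 :: 'a)"
      using pos by (subst sum_power_UNIV) simp_all
    then show "of_nat (a choose r) * of_nat (b choose s) * (\<Sum>x\<in>UNIV. x ^ ((r + b) + p * (s + a))) =
        (if r = p - 1 - b \<and> s = p - 1 - a
          then - (of_nat (a choose r) * of_nat (b choose s)) else 0 :: 'a)"
      by simp
  qed
  also have "\<dots> = (\<Sum>r\<le>a. if r = p - 1 - b then (\<Sum>s\<le>b. if s = p - 1 - a
      then - (of_nat (a choose r) * of_nat (b choose s)) else 0) else 0)"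
    by (intro sum.cong refl) auto
  also have "\<dots> = - (of_nat (a choose (p - 1 - b)) * of_nat (b choose (p - 1 - a)))"
    using assms by auto
  finally show ?thesis
    using assms of_nat_binomial_neq_0[of "p - 1 - b" a] of_nat_binomial_neq_0[of "p - 1 - a" b]
    by simp
qed

lemma of_nat_neq_0: "0 < m \<Longrightarrow> m < p \<Longrightarrow> of_nat m \<noteq> (0 :: 'a)"
  by (auto simp: of_nat_eq_0_iff dest: dvd_imp_le)

subsection \<open>Exclusion of exponents\<close>

lemma frob_numeral [simp]: "numeral m ^ p = (numeral m :: 'a)"
  using of_nat_in_K[of "numeral m"] by (simp add: K_def)

lemma numeral_in_K [simp]: "numeral m \<in> K"
  by (simp add: K_def)

lemma p_pos: "0 < p"
  using p_gt_1 by simp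

lemma numeral_neq_0:
  assumes "5 \<le> p"
  shows "(2 :: 'a) \<noteq> 0" "(3 :: 'a) \<noteq> 0"
  using of_nat_neq_0[of 2] of_nat_neq_0[of 3] assms by simp_all

lemma anti_fixed_not_in_K:
  assumes "5 \<le> p" "\<beta> \<noteq> 0" "\<beta> ^ p = - \<beta>"
  shows "\<beta> \<notin> K"
proof
  assume "\<beta> \<in> K"
  with assms(3) have "2 * \<beta> = 0"
    by (simp add: K_def eq_neg_iff_add_eq_0)
  with assms(2) numeral_neq_0(1)[OF assms(1)] show False
    by simp
qed

lemma k_PN_injD:
  assumes "k_PN k f" "length as = k" "0 \<notin> set as"
    and "poly (iterated_diff f as) x = poly (iterated_diff f as) y"
  shows "x = y"
proof -
  have "inj (poly (iterated_diff f as))"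
    using assms by (auto simp: k_PN_def bij_def)
  with assms(4) show ?thesis
    by (simp add: inj_eq)
qed

lemma k_PN_corr_0:
  assumes "k_PN k f" "length as = k" "0 \<notin> set as" "3 \<le> p"
  shows "corr (poly (iterated_diff f as)) 0 = 0"
  using assms by (intro corr_bij_0) (auto simp: k_PN_def)

section \<open>Digit sum \<open>p + k\<close>\<close>

lemma not_2_PN_power:
  assumes "5 \<le> p" "a < p" "b < p" "a + b = p + 2" "a + b + 3 \<le> 2 * p"
  shows "\<not> k_PN 2 (monom 1 (a + b * p) :: 'a poly)"
proof
  define f where "f = (monom 1 (a + b * p) :: 'a poly)"
  assume pn: "k_PN 2 (monom 1 (a + b * p) :: 'a poly)"
  obtain \<beta> :: 'a where \<beta>: "\<beta> \<noteq> 0" "\<beta> ^ p = - \<beta>"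
    using ex_anti_fixed by blast
  define s where "s = \<beta> ^ 2"
  define R where "R = corr (\<lambda>x. x ^ (a + b * p)) 1"
  have "[a + b * p = 3] (mod (p - 1))"
    using k_PN_exponent_cong[OF pn] by simp
  then have corr: "corr (poly f) d = R * (d * d ^ p) ^ 3" for d
    unfolding R_def f_def poly_monom mult_1_left
    using assms by (subst corr_power) (auto dest: dvd_imp_le)
  \<comment> \<open>The norm of u + v \<beta> is u^2 - s v^2 for u, v in \<open>K\<close>, so the
    fourth difference is 4 R ((1 - s)^3 - 1 + s^3).\<close>
  have "corr (poly (iterated_diff f [1, \<beta>])) 0 = 12 * R * s * (s - 1)"
    by (simp add: corr_finite_diff corr frob_add frob_diff frob_minus s_def \<beta>(2) p_pos) algebra
  moreover have "corr (poly (iterated_diff f [1, \<beta>])) 0 = 0"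
    unfolding f_def using \<beta> assms by (intro k_PN_corr_0[OF pn]) auto
  moreover have "R \<noteq> 0"
    unfolding R_def using assms by (intro corr_power_1_neq_0) auto
  moreover have "s \<noteq> 0"
    using \<beta> by (simp add: s_def)
  moreover have "s \<noteq> 1"
  proof
    assume "s = 1"
    then have "\<beta> = 1 \<or> \<beta> = - 1"
      by (simp add: s_def power2_eq_1_iff)
    then have "\<beta> \<in> K"
      by auto
    with anti_fixed_not_in_K \<beta> assms(1) show False
      by blast
  qed
  moreover have "(12 :: 'a) \<noteq> 0"
  proof -
    have "(12 :: 'a) = 2 * 2 * 3"
      by simp
    with numeral_neq_0[OF assms(1)] show ?thesis
      by (metis mult_eq_0_iff)
  qed
  ultimately show False
    by simp
qed

lemma not_3_PN_power:
  assumes "7 \<le> p" "a < p" "b < p" "a + b = p + 3" "a + b + 3 \<le> 2 * p"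
  shows "\<not> k_PN 3 (monom 1 (a + b * p) :: 'a poly)"
proof
  define f where "f = (monom 1 (a + b * p) :: 'a poly)"
  assume pn: "k_PN 3 (monom 1 (a + b * p) :: 'a poly)"
  obtain \<beta> :: 'a where \<beta>: "\<beta> \<noteq> 0" "\<beta> ^ p = - \<beta>"
    using ex_anti_fixed by blast
  have n0: "(2 :: 'a) \<noteq> 0" "(3 :: 'a) \<noteq> 0" "(5 :: 'a) \<noteq> 0"
    using numeral_neq_0 of_nat_neq_0[of 5] assms by simp_all
  define R where "R = corr (\<lambda>x. x ^ (a + b * p)) 1"
  have "[a + b * p = 4] (mod (p - 1))"
    using k_PN_exponent_cong[OF pn] by simp
  then have corr: "corr (poly f) d = R * (d * d ^ p) ^ 4" for d
    unfolding R_def f_def poly_monom mult_1_left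
    using assms by (subst corr_power) (auto dest: dvd_imp_le)
  have "R \<noteq> 0"
    unfolding R_def using assms by (intro corr_power_1_neq_0) auto
  have eq: "3 * \<gamma> ^ 2 = 10" if \<gamma>: "\<gamma> \<noteq> 0" "\<gamma> ^ p = - \<gamma>" for \<gamma> :: 'a
  proof -
    have "corr (poly (iterated_diff f [1, 1, \<gamma>])) 0 = 96 * R * \<gamma> ^ 2 * (10 - 3 * \<gamma> ^ 2)"
      by (simp add: corr_finite_diff corr frob_add frob_diff frob_minus \<gamma>(2) p_pos) algebra
    moreover have "corr (poly (iterated_diff f [1, 1, \<gamma>])) 0 = 0"
      unfolding f_def using \<gamma> assms by (intro k_PN_corr_0[OF pn]) auto
    moreover have "(96 :: 'a) \<noteq> 0"
    proof -
      have "(96 :: 'a) = 2 ^ 5 * 3"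
        by simp
      with n0 show ?thesis
        by (metis mult_eq_0_iff power_not_zero)
    qed
    ultimately show ?thesis
      using \<open>R \<noteq> 0\<close> \<gamma>(1) by simp
  qed
  \<comment> \<open>A single \<beta> might satisfy the equation; applying it to 2 \<beta> as well
    forces 30 = 0.\<close>
  have "3 * (2 * \<beta>) ^ 2 = 10"
    using \<beta> n0 by (intro eq) (auto simp: power_mult_distrib)
  moreover have "3 * (2 * \<beta>) ^ 2 = 4 * (3 * \<beta> ^ 2)"
    by (simp add: power2_eq_square)
  ultimately have "4 * 10 - 10 = (0 :: 'a)"
    using eq[OF \<beta>] by (metis diff_self)
  then have "2 * 3 * 5 = (0 :: 'a)"
    by simp
  with n0 show False
    by (metis mult_eq_0_iff)
qed

text \<open>The monomial is 1 off 0. From a point outside \<open>K\<close>, steps of 1 never reach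
  0, so the third difference vanishes at both \<beta> and 2 \<beta>.\<close>

lemma not_3_PN_power_q_minus_1:
  assumes "5 \<le> p"
  shows "\<not> k_PN 3 (monom 1 (p ^ 2 - 1) :: 'a poly)"
proof
  assume pn: "k_PN 3 (monom 1 (p ^ 2 - 1) :: 'a poly)"
  obtain \<beta> :: 'a where \<beta>: "\<beta> \<noteq> 0" "\<beta> ^ p = - \<beta>"
    using ex_anti_fixed by blast
  have pow: "x ^ (p ^ 2 - 1) = 1" if "x \<notin> K" for x :: 'a
    using that by (intro power_q_minus_1) auto
  have nK: "y + c \<notin> K" "c + y \<notin> K" if "y \<notin> K" "c \<in> K" for y c
    using that K_closed(2)[of "y + c" c] by (auto simp: add.commute)
  have "poly (iterated_diff (monom 1 (p ^ 2 - 1)) [1, 1, 1]) y = 0" if y: "y \<notin> K" for y :: 'a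
    using y by (simp add: poly_finite_diff poly_monom pow nK del: power_Suc One_nat_def)
  moreover have "\<beta> \<notin> K" "2 * \<beta> \<notin> K"
    using \<beta> numeral_neq_0(1)[OF assms]
    by (intro anti_fixed_not_in_K[OF assms]; simp add: power_mult_distrib)+
  ultimately have "poly (iterated_diff (monom 1 (p ^ 2 - 1)) [1, 1, 1]) \<beta> =
      poly (iterated_diff (monom 1 (p ^ 2 - 1)) [1, 1, 1]) (2 * \<beta>)"
    by metis
  then have "\<beta> = 2 * \<beta>"
    by (rule k_PN_injD[OF pn, rotated 2]) simp_all
  then have "\<beta> = 0"
    by (metis add_0_right add_left_cancel mult_2)
  with \<beta>(1) show False ..
qed

section \<open>Digit sum \<open>k + 1\<close> and small characteristic\<close>

text \<open>With t = (p + 1) / 3 and r = (p^2 - 1) / 3, take c = y^t and v = y^r for some y with y^r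
  different from 1; then c^(p - 1) = v is a primitive cube root of unity.\<close>

lemma ex_cube_root_of_unity_power:
  assumes "3 dvd p + 1"
  shows "\<exists>c v::'a. c \<noteq> 0 \<and> c ^ p = c * v \<and> v ^ 2 + v + 1 = 0"
proof -
  obtain t where t: "p + 1 = 3 * t"
    using assms ..
  define r where "r = t * (p - 1)"
  have q: "p ^ 2 - 1 = 3 * r"
  proof -
    have "p ^ 2 - 1 = (p - 1) * (p + 1)"
      by (simp add: power2_eq_square algebra_simps)
    then show ?thesis
      by (simp only: t r_def mult_ac)
  qed
  have "0 < r"
    using t p_gt_1 by (cases t) (auto simp: r_def)
  then obtain y :: 'a where y: "y \<noteq> 0" "y ^ r \<noteq> 1"
    using mult_closed_ex_power_ne_1[of r "UNIV - {0 :: 'a}"] q by (auto simp: card_UNIV)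
  define c v where "c = y ^ t" and "v = y ^ r"
  have "v ^ 3 = 1"
    using power_q_minus_1[OF y(1)] q by (simp add: v_def mult.commute flip: power_mult)
  then have "(v - 1) * (v ^ 2 + v + 1) = 0"
    by (simp add: power2_eq_square power3_eq_cube algebra_simps)
  then have "v ^ 2 + v + 1 = 0"
    using y(2) by (simp add: v_def)
  moreover have "c ^ p = c * v"
  proof -
    have "t * p = t + r"
      using p_gt_1 by (simp add: r_def algebra_simps)
    then show ?thesis
      by (simp add: c_def v_def flip: power_mult power_add)
  qed
  ultimately show ?thesis
    using y(1) c_def by (intro exI[of _ c] exI[of _ v]) simp
qed

text \<open>\<open>D 1 - D 0\<close> is the polarization of the cubic form x^n at c, c^2 and 1. The
  choice of directions makes its three kinds of terms proportional to 1, v and v^2.\<close>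

lemma not_2_PN_cube_root:
  assumes "3 dvd p + 1" "n = 2 + p \<or> n = 1 + 2 * p"
  shows "\<not> k_PN 2 (monom 1 n :: 'a poly)"
proof
  assume pn: "k_PN 2 (monom 1 n :: 'a poly)"
  obtain c v :: 'a where c: "c \<noteq> 0" "c ^ p = c * v" "v ^ 2 + v + 1 = 0"
    using ex_cube_root_of_unity_power[OF assms(1)] by blast
  have c2: "(c ^ 2) ^ p = c ^ 2 * v ^ 2"
    using c(2) by (metis mult.commute power_mult power_mult_distrib)
  have pow: "x ^ n = x ^ 2 * x ^ p" if "n = 2 + p" for x :: 'a
    by (simp only: that power_add)
  have pow': "x ^ n = x * (x ^ p) ^ 2" if "n = 1 + 2 * p" for x :: 'a
    by (simp only: that power_add power_one_right mult.commute[of 2 p] power_mult)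
  define D where "D = poly (iterated_diff (monom 1 n) [c, c ^ 2])"
  have "D 1 - D 0 = 2 * c ^ 3 * (v ^ 2 + v + 1) \<or> D 1 - D 0 = 2 * c ^ 3 * v * (v ^ 2 + v + 1)"
    using assms(2)
  proof
    assume "n = 2 + p"
    note pow[OF this, simp]
    have "D 1 - D 0 = 2 * c ^ 3 * (v ^ 2 + v + 1)"
      by (simp add: D_def poly_finite_diff poly_monom frob_add c(2) c2 p_pos) algebra
    then show ?thesis ..
  next
    assume "n = 1 + 2 * p"
    note pow'[OF this, simp]
    have "D 1 - D 0 = 2 * c ^ 3 * v * (v ^ 2 + v + 1)"
      by (simp add: D_def poly_finite_diff poly_monom frob_add c(2) c2 p_pos) algebra
    then show ?thesis ..
  qed
  then have "poly (iterated_diff (monom 1 n) [c, c ^ 2]) 1 = poly (iterated_diff (monom 1 n) [c, c ^ 2]) 0"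
    using c(3) by (simp add: D_def)
  then have "1 = (0 :: 'a)"
    by (rule k_PN_injD[OF pn, rotated 2]) (use c(1) in simp_all)
  then show False
    by simp
qed

text \<open>The difference of the values at 1 and 0 is the polarization of a quartic form at the
  three directions and 1. Frobenius fixes 1 and negates \<beta>, and the directions are chosen so
  that equally many terms carry each sign.\<close>

lemma not_3_PN_sum_4:
  assumes "n = 3 + p \<or> n = 2 + 2 * p \<or> n = 1 + 3 * p"
  shows "\<not> k_PN 3 (monom 1 n :: 'a poly)"
proof
  assume pn: "k_PN 3 (monom 1 n :: 'a poly)"
  obtain \<beta> :: 'a where \<beta>: "\<beta> \<noteq> 0" "\<beta> ^ p = - \<beta>"
    using ex_anti_fixed by blast
  have split: "x ^ (i + j * p) = x ^ i * (x ^ p) ^ j" for x :: 'a and i j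
    by (simp only: power_add mult.commute[of j p] power_mult)
  from assms obtain as :: "'a list" where as: "length as = 3" "0 \<notin> set as"
    "poly (iterated_diff (monom 1 n) as) 1 = poly (iterated_diff (monom 1 n) as) 0"
  proof (elim disjE)
    assume "n = 3 + p"
    then have [simp]: "x ^ n = x ^ 3 * x ^ p" for x :: 'a
      by (simp only: power_add)
    have "poly (iterated_diff (monom 1 n) [1, \<beta>, \<beta>]) 1 =
        poly (iterated_diff (monom 1 n) [1, \<beta>, \<beta>]) 0"
      by (simp add: poly_finite_diff poly_monom frob_add \<beta>(2) p_pos) algebra
    then show ?thesis
      using \<beta>(1) by (intro that[of "[1, \<beta>, \<beta>]"]) auto
  next
    assume "n = 2 + 2 * p"
    then have [simp]: "x ^ n = x ^ 2 * (x ^ p) ^ 2" for x :: 'a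
      by (simp only: split)
    have "poly (iterated_diff (monom 1 n) [1, 1, \<beta>]) 1 =
        poly (iterated_diff (monom 1 n) [1, 1, \<beta>]) 0"
      by (simp add: poly_finite_diff poly_monom frob_add \<beta>(2) p_pos) algebra
    then show ?thesis
      using \<beta>(1) by (intro that[of "[1, 1, \<beta>]"]) auto
  next
    assume "n = 1 + 3 * p"
    then have [simp]: "x ^ n = x * (x ^ p) ^ 3" for x :: 'a
      by (simp only: split power_one_right)
    have "poly (iterated_diff (monom 1 n) [1, \<beta>, \<beta>]) 1 =
        poly (iterated_diff (monom 1 n) [1, \<beta>, \<beta>]) 0"
      by (simp add: poly_finite_diff poly_monom frob_add \<beta>(2) p_pos) algebra
    then show ?thesis
      using \<beta>(1) by (intro that[of "[1, \<beta>, \<beta>]"]) auto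
  qed
  from k_PN_injD[OF pn this] show False
    by simp
qed

text \<open>The third difference in direction 1 is 4 (f(x + 1) - f(x)) in characteristic 2 and f(x +
  3) - f(x) in characteristic 3, hence zero.\<close>

lemma not_3_PN_small_char:
  assumes "p < 5"
  shows "\<not> k_PN 3 (f :: 'a poly)"
proof
  assume pn: "k_PN 3 f"
  have "p \<noteq> 4"
    using prime_p by (auto simp: prime_nat_iff dest: spec[of _ 2])
  then consider "p = 2" | "p = 3"
    using assms p_gt_1 by linarith
  then have "poly (iterated_diff f [1, 1, 1]) 1 = poly (iterated_diff f [1, 1, 1]) 0"
  proof cases
    case 1
    then have "1 + 1 = (0 :: 'a)"
      using of_nat_p by simp
    then show ?thesis
      by (simp add: poly_finite_diff del: one_add_one)
  next
    case 2
    then have 3: "1 + 1 + 1 = (0 :: 'a)"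
      using of_nat_p by simp
    then show ?thesis
      by (simp add: poly_finite_diff del: one_add_one)
  qed
  then have "1 = (0 :: 'a)"
    by (rule k_PN_injD[OF pn, rotated 2]) simp_all
  then show False
    by simp
qed

section \<open>From digit sums to exponents\<close>

text \<open>Since p is 1 modulo p - 1, the digit sum is congruent to n, hence to k + 1; its range
  from 1 to 2 (p - 1) leaves only two values.\<close>

lemma digit_sum_k_PN:
  assumes "k_PN k (monom 1 n :: 'a poly)" "1 \<le> k" "k + 2 \<le> p" "n \<le> p ^ 2 - 1"
  obtains a b where "n = a + b * p" "a < p" "b < p" "a + b = k + 1 \<or> a + b = p + k"
proof (rule that)
  define a b where "a = n mod p" and "b = n div p"
  show n: "n = n mod p + n div p * p"
    by simp
  show "n mod p < p"
    using p_gt_1 by simp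
  have "n < p * p"
    using assms(4) p_pos by (simp add: power2_eq_square Suc_le_eq flip: less_Suc_eq_le)
  then show "n div p < p"
    by (simp add: less_mult_imp_div_less)
  have "n = (a + b) + b * (p - 1)"
    using n p_gt_1 by (simp add: a_def b_def algebra_simps)
  then have "[a + b = n] (mod (p - 1))"
    by (simp add: cong_def)
  with k_PN_exponent_cong[OF assms(1,2)] have cong: "[a + b = k + 1] (mod (p - 1))"
    using cong_trans by blast
  have bound: "a + b \<le> 2 * (p - 1)"
    using \<open>n mod p < p\<close> \<open>n div p < p\<close> unfolding a_def b_def by linarith
  have "a + b \<noteq> 0"
    using k_PN_exponent_neq_0[OF assms(1,2)] n unfolding a_def b_def by (metis add_is_0 mult_0)
  show "n mod p + n div p = k + 1 \<or> n mod p + n div p = p + k"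
  proof (cases "k + 1 \<le> a + b")
    case True
    then have "p - 1 dvd (a + b) - (k + 1)"
      using cong by (metis cong_altdef_nat cong_sym)
    then obtain c where c: "(a + b) - (k + 1) = (p - 1) * c" ..
    have "(p - 1) * c < (p - 1) * 2"
      using bound c True by linarith
    then have "c = 0 \<or> c = 1"
      using mult_less_cancel1 by (metis less_2_cases One_nat_def)
    then show ?thesis
      using c True p_gt_1 unfolding a_def b_def by auto
  next
    \<comment> \<open>A smaller digit sum would be at least p - 1 below k + 1; being positive, it
      would force p - 1 \<le> k.\<close>
    case False
    then have "p - 1 dvd (k + 1) - (a + b)"
      using cong by (metis cong_altdef_nat cong_sym nat_le_linear)
    then have "p - 1 \<le> (k + 1) - (a + b)"
      using False by (intro dvd_imp_le) auto
    then show ?thesis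
      using \<open>a + b \<noteq> 0\<close> assms(3) by linarith
  qed
qed

lemma k_PN_2_monomial:
  assumes "5 \<le> p" "n \<le> p ^ 2 - 1" and pn: "k_PN 2 (monom 1 n :: 'a poly)"
  shows "n \<in> {3, 3 * p, 1 + 2 * p, 2 + p}"
proof -
  obtain a b where ab: "n = a + b * p" "a < p" "b < p" "a + b = 3 \<or> a + b = p + 2"
    using digit_sum_k_PN[OF pn _ _ assms(2)] assms(1) by auto
  have "a + b \<noteq> p + 2"
    using not_2_PN_power[of a b] ab pn assms(1) by auto
  then have "a + b = 3"
    using ab by simp
  then have "a = 3 \<and> b = 0 \<or> a = 2 \<and> b = 1 \<or> a = 1 \<and> b = 2 \<or> a = 0 \<and> b = 3"
    by linarith
  then show ?thesis
    using ab(1) by auto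
qed

lemma k_PN_3_monomial:
  assumes "n \<le> p ^ 2 - 1" and pn: "k_PN 3 (monom 1 n :: 'a poly)"
  shows "n \<in> {4, 4 * p}"
proof -
  have p5: "5 \<le> p"
    using not_3_PN_small_char pn not_le by blast
  obtain a b where ab: "n = a + b * p" "a < p" "b < p" "a + b = 4 \<or> a + b = p + 3"
    using digit_sum_k_PN[OF pn _ _ assms(1)] p5 by auto
  have "a + b \<noteq> p + 3"
  proof
    assume sum: "a + b = p + 3"
    show False
    proof (cases "7 \<le> p")
      case True
      then show False
        using not_3_PN_power[of a b] ab sum pn by auto
    next
      case False
      have "p \<noteq> 6"
        using prime_p by (auto simp: prime_nat_iff dest: spec[of _ 2])
      with False p5 have "p = 5"
        by simp
      with sum ab have "a = 4" "b = 4"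
        by auto
      with ab(1) \<open>p = 5\<close> have "n = p ^ 2 - 1"
        by simp
      with not_3_PN_power_q_minus_1[OF p5] pn show False
        by simp
    qed
  qed
  then have "a + b = 4"
    using ab by simp
  then have "a = 4 \<and> b = 0 \<or> a = 3 \<and> b = 1 \<or> a = 2 \<and> b = 2 \<or> a = 1 \<and> b = 3 \<or> a = 0 \<and> b = 4"
    by linarith
  moreover have "n \<noteq> 3 + p" "n \<noteq> 2 + 2 * p" "n \<noteq> 1 + 3 * p"
    using not_3_PN_sum_4 pn by blast+
  ultimately show ?thesis
    using ab(1) by auto
qed

end

theorem theorem1p4:
  fixes p n :: nat
  assumes "prime p"
    and "CARD('a::{field, finite}) = p ^ 2"
    and "n \<le> p ^ 2 - 1"
  shows "(p \<ge> 5 \<and> k_PN 2 (monom 1 n :: 'a poly) \<longrightarrow>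
            ([int p = -1] (mod 3) \<longrightarrow> n \<in> {3, 3 * p}) \<and>
            ([int p = 1] (mod 3) \<longrightarrow> n \<in> {3, 3 * p, 1 + 2 * p, 2 + p}))
       \<and> (k_PN 3 (monom 1 n :: 'a poly) \<longrightarrow> n \<in> {4, 4 * p})"
proof -
  interpret prime_square_field p "TYPE('a)"
    using assms by unfold_locales
  have "n \<in> {3, 3 * p}"
    if "5 \<le> p" "k_PN 2 (monom 1 n :: 'a poly)" "[int p = -1] (mod 3)"
  proof -
    have "int 3 dvd int (p + 1)"
      using that(3) by (simp add: cong_iff_dvd_diff add.commute)
    then have "3 dvd p + 1"
      by (simp only: of_nat_dvd_iff)
    then show ?thesis
      using k_PN_2_monomial[OF that(1) assms(3) that(2)] not_2_PN_cube_root that(2) by blast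
  qed
  then show ?thesis
    using k_PN_2_monomial k_PN_3_monomial assms(3) by blast
qed

end
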